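(* Let $G$ be a quasi-tree such that at least one of the following holds: (i) $G$ contains no pendent vertices (vertices of degree $1$); (ii) $G$ contains a quasi-vertex $x$ none of whose neighbors has degree $2$ in $G$. Then ${\rm gp}(G)\geq {\rm Z}(G)$.
   Context: All graphs are finite and simple. A graph $G$ is a quasi-tree if it contains a vertex $v$ such that $G-v$ is a tree; such a $v$ is called a quasi-vertex of $G$. Zero forcing: given a set $S\subseteq V(G)$ of initially black vertices (all others white), the color-change rule turns a white vertex $y$ black if $y$ is the only white neighbor of some black vertex $x$. ${\rm Z}(G)$ is the minimum size of a set $S$ such that repeated application of the rule eventually turns all vertices black. A set $R\subseteq V(G)$ is a general position set if no three vertices of $R$ lie on a common shortest path of $G$; ${\rm gp}(G)$ is the maximum size of a general position set of $G$. *)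

theory Defs
  imports "Graph_Theory.Graph_Theory"
begin

text \<open>
  Finite simple graphs are the symmetric digraphs of the locale \<^locale>\<open>graph\<close>: every edge
  is a pair of opposite arcs, so the degree of a vertex is its \<^const>\<open>out_degree\<close>.
\<close>

text \<open>
  In a symmetric digraph every edge, traversed back and forth, is a \<^const>\<open>pre_digraph.cycle\<close>
  of length 2, so \<^const>\<open>tree\<close> cannot be used for undirected graphs; the cycles of an
  undirected simple graph are those of length at least 3. \<^const>\<open>connected\<close> excludes the
  null graph.
\<close>

definition undirected_tree :: "('a, 'b) pre_digraph \<Rightarrow> bool" where
  "undirected_tree G \<longleftrightarrow> connected G \<and> \<not> (\<exists>p. pre_digraph.cycle G p \<and> 3 \<le> length p)"

definition quasi_vertex :: "('a, 'b) pre_digraph \<Rightarrow> 'a \<Rightarrow> bool" where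
  "quasi_vertex G v \<longleftrightarrow> v \<in> verts G \<and> undirected_tree (pre_digraph.del_vert G v)"

definition quasi_tree :: "('a, 'b) pre_digraph \<Rightarrow> bool" where
  "quasi_tree G \<longleftrightarrow> (\<exists>v. quasi_vertex G v)"

definition pendent_vertex :: "('a, 'b) pre_digraph \<Rightarrow> 'a \<Rightarrow> bool" where
  "pendent_vertex G v \<longleftrightarrow> v \<in> verts G \<and> out_degree G v = 1"

text \<open>
  One application of the color-change rule; \<open>B\<close> and \<open>B'\<close> are the sets of black vertices
  before and after.
\<close>

definition color_change :: "('a, 'b) pre_digraph \<Rightarrow> 'a set \<Rightarrow> 'a set \<Rightarrow> bool" where
  "color_change G B B' \<longleftrightarrow>
     (\<exists>x \<in> B. \<exists>y. {z. x \<rightarrow>\<^bsub>G\<^esub> z \<and> z \<notin> B} = {y} \<and> B' = insert y B)"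

definition zero_forcing_set :: "('a, 'b) pre_digraph \<Rightarrow> 'a set \<Rightarrow> bool" where
  "zero_forcing_set G S \<longleftrightarrow> S \<subseteq> verts G \<and> (color_change G)\<^sup>*\<^sup>* S (verts G)"

definition zero_forcing_number :: "('a, 'b) pre_digraph \<Rightarrow> nat" where
  "zero_forcing_number G = Min (card ` {S. zero_forcing_set G S})"

definition shortest_path :: "('a, 'b) pre_digraph \<Rightarrow> 'a vwalk \<Rightarrow> bool" where
  "shortest_path G p \<longleftrightarrow> vpath p G \<and>
     (\<forall>q. vpath q G \<and> hd q = hd p \<and> last q = last p \<longrightarrow> vwalk_length p \<le> vwalk_length q)"

definition general_position_set :: "('a, 'b) pre_digraph \<Rightarrow> 'a set \<Rightarrow> bool" where
  "general_position_set G R \<longleftrightarrow> R \<subseteq> verts G \<and>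
     \<not> (\<exists>a \<in> R. \<exists>b \<in> R. \<exists>c \<in> R. a \<noteq> b \<and> b \<noteq> c \<and> a \<noteq> c \<and>
         (\<exists>p. shortest_path G p \<and> {a, b, c} \<subseteq> set p))"

definition gp_number :: "('a, 'b) pre_digraph \<Rightarrow> nat" where
  "gp_number G = Max (card ` {R. general_position_set G R})"

text \<open>For a finite vertex set, the minimum and the maximum are over finite nonempty sets.\<close>

lemma finite_zero_forcing_sets:
  assumes "finite (verts G)"
  shows "finite {S. zero_forcing_set G S}" "{S. zero_forcing_set G S} \<noteq> {}"
proof -
  show "finite {S. zero_forcing_set G S}"
    by (rule finite_subset[of _ "Pow (verts G)"])
       (use assms in \<open>auto simp: zero_forcing_set_def\<close>)
  have "zero_forcing_set G (verts G)"
    by (simp add: zero_forcing_set_def)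
  then show "{S. zero_forcing_set G S} \<noteq> {}" by blast
qed

lemma finite_general_position_sets:
  assumes "finite (verts G)"
  shows "finite {R. general_position_set G R}" "{R. general_position_set G R} \<noteq> {}"
proof -
  show "finite {R. general_position_set G R}"
    by (rule finite_subset[of _ "Pow (verts G)"])
       (use assms in \<open>auto simp: general_position_set_def\<close>)
  have "general_position_set G {}"
    by (simp add: general_position_set_def)
  then show "{R. general_position_set G R} \<noteq> {}" by blast
qed

end

theory Submission
  imports Defs
begin

text \<open>
  Let \<open>x\<close> be a quasi-vertex and \<open>L\<close> the set of leaves of the tree \<open>T = G - x\<close>, where \<open>T\<close> has at
  least two vertices; then \<open>Z(G) \<le> |L| \<le> gp(G)\<close>. For the first inequality, \<open>x\<close> together with all
  leaves but one is a zero forcing set: were the process to get stuck, every black vertex of \<open>T\<close> with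
  a white neighbour would have two of them, and every white vertex but the omitted leaf would have
  two neighbours, so a path in \<open>T\<close> without consecutive black vertices, started at the omitted leaf
  if that is white, could be prolonged forever. For the second, if a leaf \<open>b\<close> of \<open>T\<close> lies on a
  shortest path strictly between two others, the path enters or leaves \<open>b\<close> through \<open>x\<close>, so \<open>b\<close> is a
  neighbour of \<open>x\<close> of degree 2; and if all leaves of \<open>T\<close> are adjacent to \<open>x\<close>, then the path
  can be shortened by going through \<open>x\<close> directly.
\<close>

section \<open>Leaves, cycles and dead ends\<close>

definition leaves :: "('a, 'b) pre_digraph \<Rightarrow> 'a set" where
  "leaves G = {v \<in> verts G. \<exists>!w. v \<rightarrow>\<^bsub>G\<^esub> w}"

lemma leavesI: "v \<in> verts G \<Longrightarrow> v \<rightarrow>\<^bsub>G\<^esub> w \<Longrightarrow> (\<And>w'. v \<rightarrow>\<^bsub>G\<^esub> w' \<Longrightarrow> w' = w) \<Longrightarrow> v \<in> leaves G"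
  unfolding leaves_def by blast

lemma leaves_adj_unique: "v \<in> leaves G \<Longrightarrow> v \<rightarrow>\<^bsub>G\<^esub> w \<Longrightarrow> v \<rightarrow>\<^bsub>G\<^esub> w' \<Longrightarrow> w = w'"
  unfolding leaves_def by blast

lemma (in sym_digraph) adj_sym: "u \<rightarrow>\<^bsub>G\<^esub> v \<Longrightarrow> v \<rightarrow>\<^bsub>G\<^esub> u"
  using sym_arcs by (rule arcs_ends_symmetric)

text \<open>Bridge from vertex lists, the form in which paths are built here, to the arc lists over
  which \<open>cycle\<close> is defined.\<close>

lemma (in wf_digraph) vwalk_imp_awalk:
  assumes "vwalk p G"
  shows "\<exists>es. awalk (hd p) es (last p) \<and> awalk_verts (hd p) es = p"
  using assms
proof (induct p rule: vwalk_induct)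
  case (Base u)
  then have "awalk u [] u" by (simp add: awalk_Nil_iff)
  then show ?case by (intro exI[of _ "[]"]) simp
next
  case (Cons u v ws)
  from Cons(1) obtain e where e: "e \<in> arcs G" "tail G e = u" "head G e = v" by auto
  from Cons(2) obtain es where es: "awalk v es (last (v # ws))" "awalk_verts v es = v # ws"
    by auto
  from e es have "awalk u (e # es) (last (v # ws))" by (simp add: awalk_Cons_iff)
  with e es show ?case by (intro exI[of _ "e # es"]) simp
qed

lemma (in wf_digraph) vpath_closing_cycle:
  assumes p: "vpath p G" and closing: "last p \<rightarrow>\<^bsub>G\<^esub> hd p"
  shows "\<exists>c. cycle c \<and> length c = length p"
proof -
  from p obtain es where es: "awalk (hd p) es (last p)" "awalk_verts (hd p) es = p"
    using vwalk_imp_awalk by blast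
  from closing obtain e where e: "e \<in> arcs G" "tail G e = last p" "head G e = hd p" by auto
  from e es have "awalk (last p) (e # es) (last p)" by (simp add: awalk_Cons_iff)
  \<comment> \<open>With the closing arc in front, the vertex list is \<open>last p # p\<close>, so
    the tail that \<open>cycle\<close> requires to be distinct is \<open>p\<close> itself.\<close>
  moreover have "distinct (tl (awalk_verts (last p) (e # es)))"
    using e es p by (auto simp: vpath_def)
  ultimately have "cycle (e # es)" unfolding cycle_def by blast
  moreover have "length (e # es) = length p"
    using length_awalk_verts[of "hd p" es] es(2) by simp
  ultimately show ?thesis by blast
qed

text \<open>
  \<open>R\<close> is a set of admissible steps; a maximal admissible path from \<open>s\<close> ends in the dead end.
\<close>

lemma (in graph) acyclic_dead_end:
  assumes acyclic: "\<not> (\<exists>c. cycle c \<and> 3 \<le> length c)"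
    and R: "R \<subseteq> arcs_ends G" and start: "(s, t) \<in> R"
  shows "\<exists>u v. (u, v) \<in> R \<and> v \<noteq> s \<and> (\<forall>w. (v, w) \<in> R \<longrightarrow> w = u)"
proof (rule ccontr)
  assume "\<not> ?thesis"
  then have extend: "\<exists>w. w \<noteq> u \<and> (v, w) \<in> R" if "(u, v) \<in> R" "v \<noteq> s" for u v
    using that by blast
  \<comment> \<open>The path is stored backwards: it grows by consing at its newest end
    \<open>p ! 0\<close>, while \<open>s\<close> stays last. Arbitrarily long paths then contradict
    finiteness.\<close>
  have "\<exists>p. vpath p G \<and> last p = s \<and> length p = n + 2 \<and> (p ! 1, p ! 0) \<in> R" for n
  proof (induct n)
    case 0
    have "s \<rightarrow>\<^bsub>G\<^esub> t" using R start by blast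
    then have "vpath [t, s] G"
      using adj_in_verts adj_sym adj_not_same by (auto simp: vpath_def vwalk_def)
    with start show ?case by (intro exI[of _ "[t, s]"]) simp
  next
    case (Suc n)
    then obtain p where p: "vpath p G" "last p = s" "length p = n + 2" "(p ! 1, p ! 0) \<in> R"
      by blast
    from p(3) obtain v u ws where p_eq: "p = v # u # ws"
      by (cases p; cases "tl p") auto
    have "s = last (u # ws)" using p(2) p_eq by simp
    then have "s \<in> set (u # ws)" by (metis last_in_set list.distinct(1))
    then have "v \<noteq> s" using p(1) p_eq by (auto simp: vpath_def)
    moreover have "(u, v) \<in> R" using p(4) p_eq by simp
    ultimately obtain w where w: "w \<noteq> u" "(v, w) \<in> R" using extend by blast
    then have vw: "v \<rightarrow>\<^bsub>G\<^esub> w" using R by blast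
    have "w \<noteq> v" using vw adj_not_same by blast
    \<comment> \<open>Otherwise the segment from \<open>v\<close> back to \<open>w\<close> closes up
      along the edge between them; since \<open>w\<close> is neither \<open>v\<close> nor
      \<open>u\<close>, this cycle has length at least 3.\<close>
    have "w \<notin> set p"
    proof
      assume "w \<in> set p"
      then obtain ys zs where split: "p = (ys @ [w]) @ zs"
        by (auto dest: split_list)
      from split p_eq w(1) \<open>w \<noteq> v\<close> obtain zs' where ys: "ys = v # u # zs'"
        by (cases ys; cases "tl ys") auto
      have "vpath (ys @ [w]) G"
        using p(1) split vwalkI_append_l[of "ys @ [w]" zs G] by (auto simp: vpath_def)
      then obtain c where "cycle c" "length c = length (ys @ [w])"
        using vpath_closing_cycle[of "ys @ [w]"] adj_sym[OF vw] ys by auto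
      with ys acyclic show False by auto
    qed
    moreover have "vwalk (w # p) G"
      using p(1) p_eq adj_sym[OF vw] by (intro vwalk_wf_digraph_consI) auto
    ultimately have "vpath (w # p) G" using p(1) by (auto simp: vpath_def)
    with p w p_eq show ?case by (intro exI[of _ "w # p"]) auto
  qed
  then obtain p where "vpath p G" "length p = card (verts G) + 2" by blast
  then have "distinct p" "set p \<subseteq> verts G" "length p > card (verts G)"
    by (auto simp: vpath_def vwalk_def)
  then show False
    using card_mono[OF finite_verts, of "set p"] distinct_card[of p] by simp
qed

section \<open>Trees: existence of a leaf and of a forcing vertex\<close>

lemma (in graph) connected_ex_adj:
  assumes "connected G" "2 \<le> card (verts G)" "v \<in> verts G"
  shows "\<exists>w. v \<rightarrow>\<^bsub>G\<^esub> w"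
proof -
  have "\<not> verts G \<subseteq> {v}"
    using assms(2) card_mono[of "{v}" "verts G"] by auto
  then obtain w where w: "w \<in> verts G" "w \<noteq> v" by blast
  have "v \<rightarrow>\<^sup>* w"
    using assms(1,3) w(1) reachable_mk_symmetric_eq[OF sym_arcs]
    unfolding connected_def strongly_connected_def by auto
  then show ?thesis
    by (cases rule: converse_reachable_cases) (use w in auto)
qed

lemma (in graph) tree_ex_leaf:
  assumes "undirected_tree G" "2 \<le> card (verts G)"
  shows "leaves G \<noteq> {}"
proof -
  have conn: "connected G" and acyclic: "\<not> (\<exists>c. cycle c \<and> 3 \<le> length c)"
    using assms(1) by (auto simp: undirected_tree_def)
  have "verts G \<noteq> {}" using assms(2) by auto
  then obtain s t where "s \<rightarrow>\<^bsub>G\<^esub> t" using connected_ex_adj[OF conn assms(2)] by blast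
  \<comment> \<open>With all arcs admissible, a dead end is a leaf.\<close>
  from acyclic_dead_end[OF acyclic subset_refl this]
  obtain u v where uv: "u \<rightarrow>\<^bsub>G\<^esub> v" "\<And>w. v \<rightarrow>\<^bsub>G\<^esub> w \<Longrightarrow> w = u" by blast
  moreover have "v \<rightarrow>\<^bsub>G\<^esub> u" using uv(1) by (rule adj_sym)
  ultimately show ?thesis using adj_in_verts(1) leavesI[of v G u] by blast
qed

text \<open>Here \<open>G\<close> is the tree left after deleting the quasi-vertex. \<open>B\<close>
  is not confined to \<open>verts G\<close>, because in the application it also contains the deleted
  vertex.\<close>

lemma (in graph) tree_force:
  assumes tree: "undirected_tree G" "2 \<le> card (verts G)"
    and black: "leaves G - {r} \<subseteq> B" and white: "w \<in> verts G" "w \<notin> B"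
    and leaf: "r \<in> leaves G"
  shows "\<exists>u \<in> verts G \<inter> B. \<exists>y. {z. u \<rightarrow>\<^bsub>G\<^esub> z \<and> z \<notin> B} = {y}"
proof (rule ccontr)
  assume stuck: "\<not> ?thesis"
  have conn: "connected G" and acyclic: "\<not> (\<exists>c. cycle c \<and> 3 \<le> length c)"
    using tree(1) by (auto simp: undirected_tree_def)
  define R where "R = {(u, v). u \<rightarrow>\<^bsub>G\<^esub> v \<and> (u \<notin> B \<or> v \<notin> B)}"
  \<comment> \<open>The dead end differs from the start, so starting at \<open>r\<close> when it is
    white keeps the dead end from being a white \<open>r\<close>.\<close>
  define s where "s = (if r \<in> B then w else r)"
  have s: "s \<in> verts G" "s \<notin> B"
    using white leaf by (auto simp: s_def leaves_def)
  then obtain t where "s \<rightarrow>\<^bsub>G\<^esub> t" using connected_ex_adj[OF conn tree(2)] by blast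
  then have "(s, t) \<in> R" using s by (simp add: R_def)
  moreover have "R \<subseteq> arcs_ends G" by (auto simp: R_def)
  ultimately obtain u v where uv: "(u, v) \<in> R" "v \<noteq> s" "\<forall>w. (v, w) \<in> R \<longrightarrow> w = u"
    using acyclic_dead_end[OF acyclic] by blast
  have adj: "u \<rightarrow>\<^bsub>G\<^esub> v" "v \<rightarrow>\<^bsub>G\<^esub> u"
    using uv(1) adj_sym[of u v] by (auto simp: R_def)
  \<comment> \<open>A black dead end could force its predecessor. At a white one every edge is
    admissible, so it is a leaf outside \<open>B\<close>, that is \<open>r\<close>.\<close>
  show False
  proof (cases "v \<in> B")
    case True
    then have "u \<notin> B" using uv(1) by (simp add: R_def)
    moreover have "z = u" if "v \<rightarrow>\<^bsub>G\<^esub> z" "z \<notin> B" for z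
      using uv(3) that by (simp add: R_def)
    ultimately have "{z. v \<rightarrow>\<^bsub>G\<^esub> z \<and> z \<notin> B} = {u}" using adj(2) by blast
    then show False using stuck True adj_in_verts(1)[OF adj(2)] by blast
  next
    case False
    then have "w = u" if "v \<rightarrow>\<^bsub>G\<^esub> w" for w
      using uv(3) that by (simp add: R_def)
    then have "v \<in> leaves G" using adj(2) adj_in_verts(1)[OF adj(2)] by (intro leavesI)
    then have "v = r" using False black by blast
    then show False using False uv(2) by (simp add: s_def)
  qed
qed

section \<open>The zero forcing number is at most the number of leaves\<close>

lemma zero_forcing_setI:
  assumes fin: "finite (verts G)" and S: "S \<subseteq> verts G"
    and step: "\<And>B. S \<subseteq> B \<Longrightarrow> B \<subset> verts G \<Longrightarrow> \<exists>B'. color_change G B B' \<and> B' \<subseteq> verts G"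
  shows "zero_forcing_set G S"
proof -
  \<comment> \<open>Each step blackens a new vertex, so the induction is on the number of white
    vertices.\<close>
  have "(color_change G)\<^sup>*\<^sup>* B (verts G)" if "S \<subseteq> B" "B \<subseteq> verts G" for B
    using that
  proof (induct "card (verts G - B)" arbitrary: B rule: less_induct)
    case less
    show ?case
    proof (cases "B = verts G")
      case False
      then obtain B' where B': "color_change G B B'" "B' \<subseteq> verts G"
        using step less.prems by blast
      then have "B \<subset> B'" by (auto simp: color_change_def)
      then have "card (verts G - B') < card (verts G - B)"
        using fin B'(2) by (intro psubset_card_mono) auto
      then have "(color_change G)\<^sup>*\<^sup>* B' (verts G)"
        using less B'(2) \<open>B \<subset> B'\<close> by blast
      with B'(1) show ?thesis by (rule converse_rtranclp_into_rtranclp)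
    qed simp
  qed
  with S show ?thesis by (auto simp: zero_forcing_set_def)
qed

lemma zero_forcing_number_le:
  assumes "finite (verts G)" "zero_forcing_set G S"
  shows "zero_forcing_number G \<le> card S"
  unfolding zero_forcing_number_def
  using assms finite_zero_forcing_sets(1) by (intro Min_le) auto

lemma gp_number_ge:
  assumes "finite (verts G)" "general_position_set G R"
  shows "card R \<le> gp_number G"
  unfolding gp_number_def
  using assms finite_general_position_sets(1) by (intro Max_ge) auto

lemma arcs_ends_del_vert:
  "arcs_ends (pre_digraph.del_vert G x) = {(u, v). u \<rightarrow>\<^bsub>G\<^esub> v \<and> u \<noteq> x \<and> v \<noteq> x}"
  by (auto simp: arcs_ends_conv pre_digraph.del_vert_simps)

lemma (in graph) graph_del_vert: "graph (del_vert x)"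
proof -
  interpret T: fin_digraph "del_vert x" by (rule fin_digraph_del_vert)
  show ?thesis
  proof
    show "tail (del_vert x) e \<noteq> head (del_vert x) e" if "e \<in> arcs (del_vert x)" for e
      using that no_loops by (auto simp: del_vert_simps)
    show "e = f" if "e \<in> arcs (del_vert x)" "f \<in> arcs (del_vert x)"
      "arc_to_ends (del_vert x) e = arc_to_ends (del_vert x) f" for e f
      using that no_multi_arcs by (auto simp: del_vert_simps ends_del_vert)
    show "symmetric (del_vert x)"
      using sym_arcs by (auto simp: symmetric_def arcs_ends_del_vert sym_def)
  qed
qed

lemma (in nomulti_digraph) out_degree_eq_card_adj: "out_degree G v = card {w. v \<rightarrow>\<^bsub>G\<^esub> w}"
proof -
  have "bij_betw (head G) (out_arcs G v) {w. v \<rightarrow>\<^bsub>G\<^esub> w}"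
    by (rule bij_betwI')
       (auto simp: arcs_ends_conv intro!: no_multi_arcs simp: arc_to_ends_def)
  then show ?thesis unfolding out_degree_def by (rule bij_betw_same_card)
qed

lemma (in graph) zero_forcing_number_le_card_leaves:
  assumes x: "quasi_vertex G x" and card: "3 \<le> card (verts G)"
  shows "zero_forcing_number G \<le> card (leaves (del_vert x))"
proof -
  let ?T = "del_vert x"
  interpret T: graph ?T by (rule graph_del_vert)
  have xG: "x \<in> verts G" and tree: "undirected_tree ?T"
    using x by (auto simp: quasi_vertex_def)
  have T2: "2 \<le> card (verts ?T)" using card xG by (simp add: verts_del_vert)
  obtain r where r: "r \<in> leaves ?T" using T.tree_ex_leaf[OF tree T2] by blast
  let ?S = "insert x (leaves ?T - {r})"
  have LT: "leaves ?T \<subseteq> verts ?T" by (auto simp: leaves_def)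
  then have finL: "finite (leaves ?T)" using finite_subset T.finite_verts by blast
  have "zero_forcing_set G ?S"
  proof (rule zero_forcing_setI)
    show "?S \<subseteq> verts G" using LT xG by (auto simp: verts_del_vert)
  next
    fix B assume B: "?S \<subseteq> B" "B \<subset> verts G"
    then obtain w where w: "w \<in> verts ?T" "w \<notin> B" by (auto simp: verts_del_vert)
    then obtain u y where u: "u \<in> verts ?T" "u \<in> B" and y: "{z. u \<rightarrow>\<^bsub>?T\<^esub> z \<and> z \<notin> B} = {y}"
      using T.tree_force[OF tree T2 _ w r] B(1) by auto
    \<comment> \<open>\<open>x\<close> is black, so restoring it gives \<open>u\<close> no further
      white neighbour.\<close>
    then have uy: "{z. u \<rightarrow>\<^bsub>G\<^esub> z \<and> z \<notin> B} = {y}"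
      using B(1) by (auto simp: arcs_ends_del_vert verts_del_vert)
    then have "color_change G B (insert y B)" using u(2) unfolding color_change_def by blast
    moreover have "y \<in> verts G" using uy adj_in_verts by blast
    ultimately show "\<exists>B'. color_change G B B' \<and> B' \<subseteq> verts G" using B(2) by blast
  qed simp
  then have "zero_forcing_number G \<le> card ?S" by (rule zero_forcing_number_le[OF finite_verts])
  \<comment> \<open>Adding \<open>x\<close> makes up for omitting \<open>r\<close>.\<close>
  also have "\<dots> = card (leaves ?T)"
    using LT card_Suc_Diff1[OF finL r] finL
    by (subst card_insert_disjoint) (auto simp: verts_del_vert)
  finally show ?thesis .
qed

section \<open>The leaves are in general position\<close>

lemma vpath_nth_adj:
  assumes "vpath p G" "Suc i < length p"
  shows "p ! i \<rightarrow>\<^bsub>G\<^esub> p ! Suc i"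
proof -
  have "vwalk p G" using assms(1) by (simp add: vpath_def)
  then show ?thesis using assms(2)
  proof (induct p arbitrary: i rule: vwalk_induct)
    case (Cons u v es)
    then show ?case by (cases i) auto
  qed simp
qed

lemma vwalk_take: "vwalk p G \<Longrightarrow> vwalk (take (Suc i) p) G"
  using vwalkI_append_l[of "take (Suc i) p" "drop (Suc i) p" G] by auto

lemma vwalk_drop: "vwalk p G \<Longrightarrow> k < length p \<Longrightarrow> vwalk (drop k p) G"
  using vwalkI_append_r[of "drop k p" "take k p" G] by auto

lemma length_vwalk_to_vpath_le: "length (vwalk_to_vpath p) \<le> length p"
proof (induct p rule: vwalk_to_vpath_induct3)
  case (in_set x xs)
  then show ?case using length_dropWhile_le[of "\<lambda>y. y \<noteq> x" xs] by simp
qed auto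

text \<open>At least three steps of \<open>p\<close> are replaced by two through \<open>x\<close>.
  As \<open>x\<close> may already lie on \<open>p\<close>, the result is only a walk;
  \<open>vwalk_to_vpath\<close> turns it into a path without lengthening it.\<close>

lemma shortest_path_no_shortcut:
  assumes p: "shortest_path G p" and ik: "i + 2 < k" "k < length p"
    and x: "p ! i \<rightarrow>\<^bsub>G\<^esub> x" "x \<rightarrow>\<^bsub>G\<^esub> p ! k" "x \<in> verts G"
  shows False
proof -
  let ?q = "take (Suc i) p @ x # drop k p"
  have vp: "vwalk p G" using p by (auto simp: shortest_path_def vpath_def)
  have last: "last (take (Suc i) p) = p ! i" using ik by (simp add: take_Suc_conv_app_nth)
  have hd: "hd (drop k p) = p ! k" using ik by (simp add: hd_drop_conv_nth)
  have "vwalk (x # drop k p) G"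
    using vwalk_drop[OF vp ik(2)] x(2,3) hd by (intro vwalk_consI) auto
  with vwalk_take[OF vp, of i] x(1) last have q: "vwalk ?q G"
    by (auto simp: vwalk_def vwalk_arcs_append)
  let ?q' = "vwalk_to_vpath ?q"
  have "vpath ?q' G" using q by (rule vwalk_to_vpath_vpath)
  moreover have "hd ?q' = hd p" "last ?q' = last p"
    using ik by (auto simp: vwalk_to_vpath_hd vwalk_to_vpath_last hd_append)
  ultimately have "vwalk_length p \<le> vwalk_length ?q'"
    using p by (auto simp: shortest_path_def)
  also have "\<dots> \<le> length ?q - 1"
    using length_vwalk_to_vpath_le[of ?q] by (simp add: diff_le_mono del: length_append)
  finally show False using ik by simp
qed

lemma (in graph) general_position_set_leaves:
  assumes cond: "(\<forall>v \<in> leaves (del_vert x). v \<rightarrow>\<^bsub>G\<^esub> x) \<or> (\<forall>v \<in> leaves (del_vert x). \<not> v \<rightarrow>\<^bsub>G\<^esub> x)"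
  shows "general_position_set G (leaves (del_vert x))"
proof -
  let ?L = "leaves (del_vert x)"
  have Lx: "x \<notin> ?L" and LG: "?L \<subseteq> verts G" by (auto simp: leaves_def verts_del_vert)
  have ordered: False
    if p: "shortest_path G p" and ijk: "i < j" "j < k" "k < length p"
      and L: "p ! i \<in> ?L" "p ! j \<in> ?L" "p ! k \<in> ?L" for p i j k
  proof -
    have vp: "vpath p G" using p by (simp add: shortest_path_def)
    have prev: "p ! j \<rightarrow>\<^bsub>G\<^esub> p ! (j - 1)"
      using vpath_nth_adj[OF vp, of "j - 1"] ijk adj_sym by simp
    have succ: "p ! j \<rightarrow>\<^bsub>G\<^esub> p ! Suc j"
      using vpath_nth_adj[OF vp, of j] ijk by simp
    have "p ! (j - 1) \<noteq> p ! Suc j"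
      using vp ijk by (auto simp: vpath_def nth_eq_iff_index_eq)
    \<comment> \<open>Two distinct neighbours on the path, but only one in the tree: the other is
      \<open>x\<close>.\<close>
    then have at: "p ! (j - 1) = x \<or> p ! Suc j = x"
      using leaves_adj_unique[OF L(2), of "p ! (j - 1)" "p ! Suc j"] prev succ L(2) Lx
      by (auto simp: arcs_ends_del_vert)
    then have "p ! j \<rightarrow>\<^bsub>G\<^esub> x" using prev succ by auto
    then have all: "\<forall>v \<in> ?L. v \<rightarrow>\<^bsub>G\<^esub> x" using cond L(2) by blast
    \<comment> \<open>One of the positions next to \<open>j\<close> holds \<open>x\<close>, which is
      no leaf, so \<open>i\<close> and \<open>k\<close> cannot both be next to
      \<open>j\<close>.\<close>
    have "i \<noteq> j - 1 \<or> k \<noteq> Suc j" using at L Lx by auto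
    then have "i + 2 < k" using ijk by auto
    then show False
      using shortest_path_no_shortcut[OF p _ ijk(3)] all L adj_sym adj_in_verts by blast
  qed
  show ?thesis
    unfolding general_position_set_def
  proof (intro conjI notI LG)
    assume "\<exists>a \<in> ?L. \<exists>b \<in> ?L. \<exists>c \<in> ?L. a \<noteq> b \<and> b \<noteq> c \<and> a \<noteq> c \<and>
         (\<exists>p. shortest_path G p \<and> {a, b, c} \<subseteq> set p)"
    then obtain a b c p where abc: "a \<in> ?L" "b \<in> ?L" "c \<in> ?L" "a \<noteq> b" "b \<noteq> c" "a \<noteq> c"
      and p: "shortest_path G p" and "a \<in> set p" "b \<in> set p" "c \<in> set p"
      by auto
    then obtain i j k where "i < length p" "j < length p" "k < length p"
      "a = p ! i" "b = p ! j" "c = p ! k"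
      by (metis in_set_conv_nth)
    with abc ordered[OF p] show False
      by (metis linorder_neqE_nat)
  qed
qed

text \<open>Restoring \<open>x\<close> leaves a leaf of the tree at degree 1 or raises it to 2,
  according to whether it is adjacent to \<open>x\<close>. The first hypothesis rules out degree 1,
  the second rules out degree 2 next to \<open>x\<close>.\<close>

lemma (in graph) leaf_adj_cond:
  assumes card: "3 \<le> card (verts G)" and x: "quasi_vertex G x"
    and cond: "\<not> (\<exists>v. pendent_vertex G v) \<or> (\<forall>y. x \<rightarrow>\<^bsub>G\<^esub> y \<longrightarrow> out_degree G y \<noteq> 2)"
  shows "(\<forall>v \<in> leaves (del_vert x). v \<rightarrow>\<^bsub>G\<^esub> x) \<or> (\<forall>v \<in> leaves (del_vert x). \<not> v \<rightarrow>\<^bsub>G\<^esub> x)"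
proof -
  have nbhd: "\<exists>w. w \<noteq> x \<and> {z. v \<rightarrow>\<^bsub>G\<^esub> z} = (if v \<rightarrow>\<^bsub>G\<^esub> x then {w, x} else {w})"
    if v: "v \<in> leaves (del_vert x)" for v
  proof -
    from v obtain w where w: "v \<rightarrow>\<^bsub>del_vert x\<^esub> w" by (auto simp: leaves_def)
    have "v \<noteq> x" using v by (auto simp: leaves_def verts_del_vert)
    have "z = w" if "v \<rightarrow>\<^bsub>G\<^esub> z" "z \<noteq> x" for z
    proof (rule leaves_adj_unique[OF v _ w])
      show "v \<rightarrow>\<^bsub>del_vert x\<^esub> z" using that \<open>v \<noteq> x\<close> by (simp add: arcs_ends_del_vert)
    qed
    then have "{z. v \<rightarrow>\<^bsub>G\<^esub> z} \<subseteq> {w, x}" by blast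
    moreover have "w \<noteq> x" "v \<rightarrow>\<^bsub>G\<^esub> w" using w by (simp_all add: arcs_ends_del_vert)
    ultimately have "{z. v \<rightarrow>\<^bsub>G\<^esub> z} = (if v \<rightarrow>\<^bsub>G\<^esub> x then {w, x} else {w})"
      by (cases "v \<rightarrow>\<^bsub>G\<^esub> x") auto
    with \<open>w \<noteq> x\<close> show ?thesis by blast
  qed
  from cond show ?thesis
  proof
    assume no_pendent: "\<not> (\<exists>v. pendent_vertex G v)"
    have "v \<rightarrow>\<^bsub>G\<^esub> x" if v: "v \<in> leaves (del_vert x)" for v
    proof (rule ccontr)
      assume "\<not> v \<rightarrow>\<^bsub>G\<^esub> x"
      with nbhd[OF v] obtain w where "{z. v \<rightarrow>\<^bsub>G\<^esub> z} = {w}" by metis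
      then have "out_degree G v = 1" by (simp add: out_degree_eq_card_adj)
      then show False
        using no_pendent v by (auto simp: pendent_vertex_def leaves_def verts_del_vert)
    qed
    then show ?thesis by blast
  next
    assume no_two: "\<forall>y. x \<rightarrow>\<^bsub>G\<^esub> y \<longrightarrow> out_degree G y \<noteq> 2"
    have "\<not> v \<rightarrow>\<^bsub>G\<^esub> x" if v: "v \<in> leaves (del_vert x)" for v
    proof
      assume vx: "v \<rightarrow>\<^bsub>G\<^esub> x"
      with nbhd[OF v] obtain w where "w \<noteq> x" "{z. v \<rightarrow>\<^bsub>G\<^esub> z} = {w, x}" by metis
      then have "out_degree G v = 2" by (simp add: out_degree_eq_card_adj)
      moreover have "x \<rightarrow>\<^bsub>G\<^esub> v" using vx by (rule adj_sym)
      ultimately show False using no_two by blast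
    qed
    then show ?thesis by blast
  qed
qed

section \<open>Small graphs and the conclusion\<close>

lemma general_position_set_card_le_2:
  assumes "R \<subseteq> verts G" "finite R" "card R \<le> 2"
  shows "general_position_set G R"
  unfolding general_position_set_def
proof (intro conjI notI assms(1))
  assume "\<exists>a \<in> R. \<exists>b \<in> R. \<exists>c \<in> R. a \<noteq> b \<and> b \<noteq> c \<and> a \<noteq> c \<and>
    (\<exists>p. shortest_path G p \<and> {a, b, c} \<subseteq> set p)"
  then obtain a b c where "{a, b, c} \<subseteq> R" "a \<noteq> b" "b \<noteq> c" "a \<noteq> c" by auto
  then show False using card_mono[OF assms(2), of "{a, b, c}"] assms(3) by auto
qed

theorem theorem3p2:
  fixes G :: "('a, 'b) pre_digraph"
  assumes "graph G"
    and "quasi_tree G"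
    and "\<not> (\<exists>v. pendent_vertex G v) \<or>
         (\<exists>x. quasi_vertex G x \<and> (\<forall>y. x \<rightarrow>\<^bsub>G\<^esub> y \<longrightarrow> out_degree G y \<noteq> 2))"
  shows "gp_number G \<ge> zero_forcing_number G"
proof -
  interpret graph G by fact
  \<comment> \<open>Without pendent vertices any quasi-vertex serves; otherwise the one given by
    (ii) is taken.\<close>
  obtain x where x: "quasi_vertex G x"
    and cond: "\<not> (\<exists>v. pendent_vertex G v) \<or> (\<forall>y. x \<rightarrow>\<^bsub>G\<^esub> y \<longrightarrow> out_degree G y \<noteq> 2)"
    using assms(2,3) unfolding quasi_tree_def by blast
  show ?thesis
  proof (cases "3 \<le> card (verts G)")
    case True
    then have "zero_forcing_number G \<le> card (leaves (del_vert x))"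
      by (rule zero_forcing_number_le_card_leaves[OF x])
    also have "\<dots> \<le> gp_number G"
      using leaf_adj_cond[OF True x cond]
      by (intro gp_number_ge general_position_set_leaves) auto
    finally show ?thesis .
  next
    case False
    \<comment> \<open>Now \<open>G - x\<close> is a single vertex and has no leaf, so counting
      leaves fails; the whole vertex set serves for both numbers instead.\<close>
    have "zero_forcing_number G \<le> card (verts G)"
      by (rule zero_forcing_number_le) (auto simp: zero_forcing_set_def)
    also have "\<dots> \<le> gp_number G"
      using False by (intro gp_number_ge general_position_set_card_le_2) auto
    finally show ?thesis .
  qed
qed

end
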